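(* Let $n\in\mathbb{N}$ and let $\eta_1,\ldots,\eta_{2n}$ be independent standard Gaussian random variables. Then $$\mathbb{E}\,\max\{\eta_1,\dots,\eta_{2n}\}\leq \mathbb{E}\,\max\{|\eta_1|,\dots,|\eta_n|\}\leq \sqrt{\frac{2n}{2n-1}}\, \mathbb{E}\,\max\{\eta_1,\dots,\eta_{2n}\}.$$ *)

theory Defs
  imports "HOL-Probability.Probability"
begin

end

theory Submission
  imports Defs
begin

text \<open>
  Write \<open>p t\<close> for the upper tail of a standard Gaussian at \<open>t\<close>. Integrating tails, the expected maxima
  are the integrals over \<open>t \<ge> 0\<close> of \<open>1 - (1 - p)^(2n) - p^(2n)\<close> and of \<open>1 - (1 - 2p)^n\<close>, where
  \<open>0 \<le> p \<le> 1/2\<close>. The lower estimate holds pointwise because \<open>1 - 2p \<le> (1 - p)^2\<close>. For \<open>n \<ge> 2\<close> the upper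
  estimate also holds pointwise, even with the smaller factor \<open>4n/(4n - 1)\<close>; this is a polynomial
  inequality, obtained by comparing a few terms of the binomial expansion of \<open>(p + (1 - p))^(2n)\<close>.
  For \<open>n = 1\<close> it fails pointwise, but the integrals agree: \<open>2 max x y = x + y + |x - y|\<close>, and the
  difference of two independent standard Gaussians is \<open>sqrt 2\<close> times a standard Gaussian.
\<close>

section \<open>Polynomial inequalities for the tail probability\<close>

text \<open>Expand \<open>1 = (p + q) ^ N\<close>. The term \<open>k = 0\<close> is
  \<open>q ^ N\<close>, the terms 1, 2, 3 cover the first summand on the left, and the terms
  \<open>N - 2\<close>, \<open>N - 1\<close>, \<open>N\<close> cover the second. The shape of the
  left side is dictated by \<open>tail_defect_le\<close>, with \<open>N = 2 * n\<close> and
  \<open>q = 1 - p\<close>.\<close>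

lemma binomial_lower_bound:
  fixes p q :: real
  assumes "6 \<le> N" "p + q = 1" "0 \<le> p" "p \<le> q"
  shows "(real N)\<^sup>2 * p\<^sup>2 * q ^ (N - 2) + 2 * real N * p ^ N \<le> 1 - q ^ N"
proof -
  define m where "m = N - 6"
  have N: "N = m + 6" using assms by (simp add: m_def)
  have q: "0 \<le> q" using assms by simp
  define f where "f k = real (N choose k) * p ^ k * q ^ (N - k)" for k
  have f_nonneg: "0 \<le> f k" for k using assms q by (simp add: f_def)
  define x where "x = real N"
  have x: "6 \<le> x" using assms by (simp add: x_def)
  have c1: "real (N choose 1) = x" by (simp add: x_def)
  have c2: "real (N choose 2) = x * (x - 1) / 2"
    by (simp add: x_def binomial_gbinomial gbinomial_prod_rev numeral_2_eq_2)
  have c3: "real (N choose 3) = x * (x - 1) * (x - 2) / 6"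
    by (simp add: x_def binomial_gbinomial gbinomial_prod_rev numeral_3_eq_3)
  have sym: "N choose (N - 1) = N choose 1" "N choose (N - 2) = N choose 2"
    using assms binomial_symmetric[of 1 N] binomial_symmetric[of 2 N] by simp_all
  have "1 = (p + q) ^ N" using assms by simp
  also have "\<dots> = (\<Sum>k\<le>N. f k)"
    by (subst binomial_ring) (simp add: f_def)
  \<comment> \<open>\<open>6 \<le> N\<close> gives \<open>3 < N - 2\<close>, so the seven indices
    are distinct and the two groups do not overlap.\<close>
  also have "\<dots> \<ge> (\<Sum>k\<in>{0, 1, 2, 3, N - 2, N - 1, N}. f k)"
    using assms f_nonneg by (intro sum_mono2) auto
  also have "(\<Sum>k\<in>{0, 1, 2, 3, N - 2, N - 1, N}. f k) =
     f 0 + f 1 + f 2 + f 3 + f (N - 2) + f (N - 1) + f N"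
    unfolding N by simp
  finally have total: "f 0 + f 1 + f 2 + f 3 + f (N - 2) + f (N - 1) + f N \<le> 1" .
  have f0: "f 0 = q ^ N" and fN: "f N = p ^ N" by (simp_all add: f_def)
  have pk: "p ^ N \<le> p ^ (N - k) * q ^ k" if "k \<le> N" for k
  proof -
    have "p ^ N = p ^ (N - k) * p ^ k" using that by (simp flip: power_add)
    also have "\<dots> \<le> p ^ (N - k) * q ^ k"
      using assms by (intro mult_left_mono power_mono) auto
    finally show ?thesis .
  qed
  have f1': "x * p ^ N \<le> f (N - 1)"
    using pk[of 1] x assms unfolding f_def sym c1
    by (simp add: mult.assoc)
  have f2': "(x * (x - 1) / 2) * p ^ N \<le> f (N - 2)"
    using mult_left_mono[OF pk[of 2], of "x * (x - 1) / 2"] x assms unfolding f_def sym c2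
    by (simp add: mult.assoc)
  have "x * 2 \<le> x * (x - 1)" using x by (intro mult_left_mono) auto
  hence "2 * x * p ^ N \<le> (x * (x - 1) / 2 + x + 1) * p ^ N"
    using assms by (intro mult_right_mono) simp_all
  also have "\<dots> \<le> f (N - 2) + f (N - 1) + f N"
    unfolding distrib_right using f1' f2' fN by linarith
  finally have high: "2 * x * p ^ N \<le> f (N - 2) + f (N - 1) + f N" .
  \<comment> \<open>The terms 1, 2, 3 dominate \<open>x\<^sup>2 p\<^sup>2 q^(N - 2)\<close> because the quadratic form left after removing
    the factor \<open>p q^(N - 3)\<close> has nonpositive discriminant for \<open>N \<ge> 6\<close>.\<close>
  define K where "K = x * (x + 1) / 2"
  define C where "C = x * (x - 1) * (x - 2) / 6"
  have disc: "K\<^sup>2 \<le> 4 * x * C"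
  proof -
    have "0 \<le> x\<^sup>2 * (5 * x * (x - 6) + 13)" using x by simp
    also have "\<dots> = 12 * (4 * x * C - K\<^sup>2)"
      by (simp add: K_def C_def power2_eq_square field_simps)
    finally show ?thesis by (simp add: mult_ac)
  qed
  have quad: "0 \<le> x * q\<^sup>2 - K * (p * q) + C * p\<^sup>2"
  proof -
    have "0 \<le> (2 * x * q - K * p)\<^sup>2 + (4 * x * C - K\<^sup>2) * p\<^sup>2" using disc by simp
    also have "\<dots> = 4 * x * (x * q\<^sup>2 - K * (p * q) + C * p\<^sup>2)"
      by (simp add: power2_eq_square algebra_simps)
    finally show ?thesis using x by (simp add: zero_le_mult_iff)
  qed
  have "0 \<le> p * q ^ (m + 3) * (x * q\<^sup>2 - K * (p * q) + C * p\<^sup>2)"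
    using quad assms q by simp
  \<comment> \<open>Here \<open>m + 3 = N - 3\<close>, and \<open>- K\<close> is the coefficient
    \<open>x * (x - 1) / 2\<close> of \<open>f 2\<close> minus \<open>x\<^sup>2\<close>.\<close>
  also have "\<dots> = f 1 + f 2 + f 3 - x\<^sup>2 * p\<^sup>2 * q ^ (N - 2)"
    unfolding f_def c1 c2 c3 K_def C_def
    by (simp add: N power_add power2_eq_square power3_eq_cube field_simps eval_nat_numeral)
  finally have low: "x\<^sup>2 * p\<^sup>2 * q ^ (N - 2) \<le> f 1 + f 2 + f 3" by simp
  show ?thesis using total low high f0 unfolding x_def by simp
qed

text \<open>With \<open>a = (1 - p)\<^sup>2\<close> and \<open>d = 1 - 2 * p\<close> one has
  \<open>a - d = p\<^sup>2\<close>, so a mean value bound on \<open>a ^ n - d ^ n\<close> reduces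
  the claim to \<open>binomial_lower_bound\<close>. The bracket is the difference of the two tail
  integrands; solving for the larger one gives the factor \<open>4n / (4n - 1)\<close>.\<close>

lemma tail_defect_le:
  fixes p :: real
  assumes "2 \<le> n" "0 \<le> p" "p \<le> 1 / 2"
  shows "4 * real n * ((1 - p) ^ (2 * n) + p ^ (2 * n) - (1 - 2 * p) ^ n) \<le> 1 - (1 - 2 * p) ^ n"
proof (cases "n = 2")
  case True
  \<comment> \<open>\<open>2 * n = 4\<close> is too small for \<open>binomial_lower_bound\<close>.
    The bracket is now \<open>2 * p\<^sup>2 * (1 - p)\<^sup>2\<close>, and the product shown is
    exactly the right side minus the left side.\<close>
  have "0 \<le> 4 * (p * (1 - p)) * (1 - 2 * p)\<^sup>2" using assms by simp
  thus ?thesis unfolding True by (simp add: algebra_simps eval_nat_numeral)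
next
  case False
  define a where "a = (1 - p)\<^sup>2"
  define d where "d = 1 - 2 * p"
  have d: "0 \<le> d" "d \<le> a" "a - d = p\<^sup>2"
    using assms by (auto simp: a_def d_def power2_eq_square algebra_simps)
  have "a ^ n - d ^ n = (a - d) * (\<Sum>i<n. d ^ (n - Suc i) * a ^ i)"
    by (rule power_diff_sumr2)
  also have "\<dots> \<le> (a - d) * (\<Sum>i<n. a ^ (n - 1))"
  proof (intro mult_left_mono sum_mono)
    fix i assume i: "i \<in> {..<n}"
    have "d ^ (n - Suc i) * a ^ i \<le> a ^ (n - Suc i) * a ^ i"
      using d by (intro mult_right_mono power_mono) auto
    also have "\<dots> = a ^ (n - 1)" using i by (simp flip: power_add)
    finally show "d ^ (n - Suc i) * a ^ i \<le> a ^ (n - 1)" .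
  qed (use d in auto)
  also have "\<dots> = real n * p\<^sup>2 * (1 - p) ^ (2 * n - 2)"
    by (simp add: d(3)) (simp add: a_def diff_mult_distrib2 flip: power_mult)
  finally have 1: "(1 - p) ^ (2 * n) - d ^ n \<le> real n * p\<^sup>2 * (1 - p) ^ (2 * n - 2)"
    by (simp add: a_def flip: power_mult)
  have "4 * real n * ((1 - p) ^ (2 * n) + p ^ (2 * n) - d ^ n) \<le>
      4 * real n * (real n * p\<^sup>2 * (1 - p) ^ (2 * n - 2) + p ^ (2 * n))"
    using 1 by (intro mult_left_mono) auto
  also have "\<dots> = (real (2 * n))\<^sup>2 * p\<^sup>2 * (1 - p) ^ (2 * n - 2) + 2 * real (2 * n) * p ^ (2 * n)"
    by (simp add: power2_eq_square algebra_simps)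
  also have "\<dots> \<le> 1 - (1 - p) ^ (2 * n)"
    using assms False by (intro binomial_lower_bound) auto
  also have "\<dots> \<le> 1 - d ^ n"
    using power_mono[OF d(2,1), of n] by (simp add: a_def flip: power_mult)
  finally show ?thesis unfolding d_def .
qed

lemma tail_upper_bound:
  fixes p :: real
  assumes "2 \<le> n" "0 \<le> p" "p \<le> 1 / 2"
  shows "1 - (1 - 2 * p) ^ n \<le> sqrt (real (2 * n) / (real (2 * n) - 1)) * (1 - (1 - p) ^ (2 * n) - p ^ (2 * n))"
proof -
  define x where "x = real n"
  have x: "2 \<le> x" using assms by (simp add: x_def)
  let ?T = "1 - (1 - p) ^ (2 * n) - p ^ (2 * n)"
  have "4 * x * (1 - (1 - 2 * p) ^ n - ?T) \<le> 1 - (1 - 2 * p) ^ n"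
    using tail_defect_le[OF assms] by (simp add: x_def algebra_simps)
  hence *: "1 - (1 - 2 * p) ^ n \<le> 4 * x / (4 * x - 1) * ?T"
    using x by (simp add: field_simps)
  have "0 \<le> 1 - (1 - 2 * p) ^ n" using assms by (simp add: power_le_one)
  \<comment> \<open>The sign of \<open>?T\<close>, required for enlarging the factor, is read off
    from \<open>*\<close> itself.\<close>
  hence "0 \<le> 4 * x / (4 * x - 1) * ?T" using * by linarith
  hence T: "0 \<le> ?T" using x by (simp add: zero_le_mult_iff zero_le_divide_iff del: of_nat_mult)
  have "4 * x / (4 * x - 1) \<le> sqrt (2 * x / (2 * x - 1))"
  proof (rule real_le_rsqrt)
    \<comment> \<open>The two sides differ by exactly \<open>2 * x\<close>.\<close>
    have "(4 * x)\<^sup>2 * (2 * x - 1) \<le> 2 * x * (4 * x - 1)\<^sup>2"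
      using x by (simp add: power2_eq_square algebra_simps)
    thus "(4 * x / (4 * x - 1))\<^sup>2 \<le> 2 * x / (2 * x - 1)"
      using x by (simp add: field_simps)
  qed
  from mult_right_mono[OF this T] * show ?thesis by (simp add: x_def)
qed

lemma tail_lower_bound:
  fixes p :: real
  assumes "0 \<le> p" "p \<le> 1 / 2"
  shows "1 - (1 - p) ^ (2 * n) - p ^ (2 * n) \<le> 1 - (1 - 2 * p) ^ n"
proof -
  have "(1 - 2 * p) ^ n \<le> ((1 - p)\<^sup>2) ^ n"
    using assms by (intro power_mono) (auto simp: power2_eq_square algebra_simps)
  also have "\<dots> = (1 - p) ^ (2 * n)" by (simp add: power_mult)
  finally have "(1 - 2 * p) ^ n \<le> (1 - p) ^ (2 * n)" .
  moreover have "0 \<le> p ^ (2 * n)" using assms by simp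
  ultimately show ?thesis by linarith
qed

section \<open>Tail integrals, independence and integrability of maxima\<close>

lemma has_bochner_integral_mono:
  fixes f g :: "'a \<Rightarrow> real"
  assumes "has_bochner_integral M f x" "has_bochner_integral M g y"
    and "\<And>t. t \<in> space M \<Longrightarrow> f t \<le> g t"
  shows "x \<le> y"
  using integral_mono[of M f g] assms by (auto simp: has_bochner_integral_iff)

context prob_space
begin

text \<open>Split \<open>X\<close> into positive and negative parts and apply Tonelli to each; the
  negative part of \<open>X\<close> is the positive part of \<open>- X\<close>. Stating it with
  \<open>has_bochner_integral\<close> supplies integrability of the integrand along with its
  value.\<close>

lemma layer_cake:
  fixes X :: "'a \<Rightarrow> real"
  assumes X: "integrable M X"
  shows "has_bochner_integral lborel
    (\<lambda>t. indicator {0..} t * (\<P>(\<omega> in M. t < X \<omega>) - \<P>(\<omega> in M. X \<omega> < - t))) (expectation X)"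
proof -
  have half: "has_bochner_integral lborel (\<lambda>t. indicator {0..} t * \<P>(\<omega> in M. t < Y \<omega>))
    (expectation (\<lambda>\<omega>. max 0 (Y \<omega>)))" if Y: "integrable M Y" for Y :: "'a \<Rightarrow> real"
  proof (rule has_bochner_integral_nn_integral)
    interpret P: pair_sigma_finite M lborel
      by (intro pair_sigma_finite.intro sigma_finite_measure_axioms lborel.sigma_finite_measure_axioms)
    have [measurable]: "Y \<in> borel_measurable M" using Y by simp
    show "(\<lambda>t. indicator {0..} t * \<P>(\<omega> in M. t < Y \<omega>)) \<in> borel_measurable lborel"
      by measurable
    show "AE t in lborel. 0 \<le> indicator {0..} t * \<P>(\<omega> in M. t < Y \<omega>)" by simp
    show "0 \<le> expectation (\<lambda>\<omega>. max 0 (Y \<omega>))" by (intro integral_nonneg_AE) simp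
    have "(\<integral>\<^sup>+ t. ennreal (indicator {0..} t * \<P>(\<omega> in M. t < Y \<omega>)) \<partial>lborel)
      = (\<integral>\<^sup>+ t. (\<integral>\<^sup>+ \<omega>. indicator {0..} t * indicator {t<..} (Y \<omega>) \<partial>M) \<partial>lborel)"
    proof (intro nn_integral_cong)
      fix t :: real
      have "(\<integral>\<^sup>+ \<omega>. indicator {0..} t * indicator {t<..} (Y \<omega>) \<partial>M)
        = indicator {0..} t * (\<integral>\<^sup>+ \<omega>. indicator {\<omega>\<in>space M. t < Y \<omega>} \<omega> \<partial>M)"
        by (cases "0 \<le> t") (auto intro!: nn_integral_cong split: split_indicator simp del: nn_integral_indicator)
      also have "\<dots> = ennreal (indicator {0..} t * \<P>(\<omega> in M. t < Y \<omega>))"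
        by (simp add: emeasure_eq_measure split: split_indicator)
      finally show "ennreal (indicator {0..} t * \<P>(\<omega> in M. t < Y \<omega>)) =
        (\<integral>\<^sup>+ \<omega>. indicator {0..} t * indicator {t<..} (Y \<omega>) \<partial>M)" by simp
    qed
    also have "\<dots> = (\<integral>\<^sup>+ \<omega>. (\<integral>\<^sup>+ t. indicator {0..} t * indicator {t<..} (Y \<omega>) \<partial>lborel) \<partial>M)"
      \<comment> \<open>Unfolding the indicators turns joint measurability into that of the
        predicate \<open>t < Y \<omega>\<close> on the product space.\<close>
      by (rule P.Fubini') (simp add: greaterThan_def indicator_def)
    also have "\<dots> = (\<integral>\<^sup>+ \<omega>. ennreal (max 0 (Y \<omega>)) \<partial>M)"
    proof (intro nn_integral_cong)
      fix \<omega>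
      have "(\<integral>\<^sup>+ t. indicator {0..} t * indicator {t<..} (Y \<omega>) \<partial>lborel)
        = (\<integral>\<^sup>+ t. indicator {0..<Y \<omega>} t \<partial>lborel)"
        by (intro nn_integral_cong) (auto split: split_indicator)
      also have "\<dots> = ennreal (max 0 (Y \<omega>))"
        by (cases "0 \<le> Y \<omega>") (auto simp: max_def)
      finally show "(\<integral>\<^sup>+ t. indicator {0..} t * indicator {t<..} (Y \<omega>) \<partial>lborel) = ennreal (max 0 (Y \<omega>))" .
    qed
    also have "\<dots> = ennreal (expectation (\<lambda>\<omega>. max 0 (Y \<omega>)))"
      using Y by (intro nn_integral_eq_integral) auto
    finally show "(\<integral>\<^sup>+ t. ennreal (indicator {0..} t * \<P>(\<omega> in M. t < Y \<omega>)) \<partial>lborel)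
      = ennreal (expectation (\<lambda>\<omega>. max 0 (Y \<omega>)))" .
  qed
  have "expectation X = expectation (\<lambda>\<omega>. max 0 (X \<omega>) - max 0 (- X \<omega>))"
    by (intro Bochner_Integration.integral_cong) auto
  also have "\<dots> = expectation (\<lambda>\<omega>. max 0 (X \<omega>)) - expectation (\<lambda>\<omega>. max 0 (- X \<omega>))"
    using X by (intro Bochner_Integration.integral_diff) auto
  finally show ?thesis
    using has_bochner_integral_diff[OF half[OF X] half[of "\<lambda>\<omega>. - X \<omega>"]] X
    by (simp add: right_diff_distrib less_minus_iff)
qed

text \<open>Meant for events bounding a maximum from above, which ask the same of every
  variable.\<close>

lemma indep_vars_prob_Ball:
  assumes "indep_vars (\<lambda>_. N) X I" "J \<subseteq> I" "finite J" "J \<noteq> {}" "A \<in> sets N"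
    and "\<And>i. i \<in> J \<Longrightarrow> \<P>(\<omega> in M. X i \<omega> \<in> A) = c"
  shows "\<P>(\<omega> in M. \<forall>i\<in>J. X i \<omega> \<in> A) = c ^ card J"
proof -
  have "{\<omega> \<in> space M. \<forall>i\<in>J. X i \<omega> \<in> A} = (\<Inter>i\<in>J. X i -` A \<inter> space M)"
    using assms(4) by auto
  also have "prob \<dots> = (\<Prod>i\<in>J. prob (X i -` A \<inter> space M))"
    using assms by (intro indep_varsD) auto
  also have "\<dots> = (\<Prod>i\<in>J. c)"
    using assms(6) by (intro prod.cong) (auto simp: vimage_def Int_def conj_commute)
  finally show ?thesis by simp
qed

text \<open>The maximum is attained, so its absolute value is dominated by the sum of all absolute
  values.\<close>

lemma integrable_Max:
  fixes X :: "'i \<Rightarrow> 'a \<Rightarrow> real"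
  assumes "finite I" "I \<noteq> {}" "\<And>i. i \<in> I \<Longrightarrow> integrable M (X i)"
  shows "integrable M (\<lambda>\<omega>. Max ((\<lambda>i. X i \<omega>) ` I))"
proof (rule Bochner_Integration.integrable_bound)
  show "integrable M (\<lambda>\<omega>. \<Sum>i\<in>I. \<bar>X i \<omega>\<bar>)" using assms by auto
  show "(\<lambda>\<omega>. Max ((\<lambda>i. X i \<omega>) ` I)) \<in> borel_measurable M"
    using assms by (intro borel_measurable_Max) auto
  show "AE \<omega> in M. norm (Max ((\<lambda>i. X i \<omega>) ` I)) \<le> norm (\<Sum>i\<in>I. \<bar>X i \<omega>\<bar>)"
  proof (rule AE_I2)
    fix \<omega>
    have "Max ((\<lambda>i. X i \<omega>) ` I) \<in> (\<lambda>i. X i \<omega>) ` I" using assms by (intro Max_in) auto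
    then obtain i where i: "i \<in> I" "Max ((\<lambda>i. X i \<omega>) ` I) = X i \<omega>" by auto
    have "\<bar>X i \<omega>\<bar> \<le> (\<Sum>i\<in>I. \<bar>X i \<omega>\<bar>)" using assms i by (intro member_le_sum) auto
    thus "norm (Max ((\<lambda>i. X i \<omega>) ` I)) \<le> norm (\<Sum>i\<in>I. \<bar>X i \<omega>\<bar>)" using i by simp
  qed
qed

section \<open>Standard Gaussian variables\<close>

lemma std_normal_uminus:
  assumes "distributed M lborel X std_normal_density"
  shows "distributed M lborel (\<lambda>\<omega>. - X \<omega>) std_normal_density"
  using normal_density_affine[OF assms, of "-1" 0] by simp

text \<open>Allows every tail to be expressed through that of one reference variable.\<close>

lemma std_normal_prob_cong:
  assumes "distributed M lborel X std_normal_density" "distributed M lborel Y std_normal_density"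
    and "A \<in> sets borel"
  shows "\<P>(\<omega> in M. X \<omega> \<in> A) = \<P>(\<omega> in M. Y \<omega> \<in> A)"
proof -
  have "emeasure M (X -` A \<inter> space M) = emeasure M (Y -` A \<inter> space M)"
    using assms by (simp add: distributed_emeasure)
  thus ?thesis by (simp add: measure_def vimage_def Int_def conj_commute)
qed

lemma std_normal_expectation_abs_cong:
  assumes "distributed M lborel X std_normal_density" "distributed M lborel Y std_normal_density"
  shows "expectation (\<lambda>\<omega>. \<bar>X \<omega>\<bar>) = expectation (\<lambda>\<omega>. \<bar>Y \<omega>\<bar>)"
  using distributed_integral[OF assms(1), of abs] distributed_integral[OF assms(2), of abs] by simp

lemma std_normal_integrable:
  assumes "distributed M lborel X std_normal_density"
  shows "integrable M X"
  using distributed_integrable_var[OF assms] integrable_std_normal_moment[of 1] by simp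

text \<open>For \<open>n = 1\<close> the constant \<open>sqrt (2n / (2n - 1))\<close> is
  \<open>sqrt 2\<close>, so the upper estimate holds there with equality.\<close>

lemma expectation_max_two_std_normal:
  assumes "indep_var borel X borel Y"
    and X: "distributed M lborel X std_normal_density"
    and Y: "distributed M lborel Y std_normal_density"
  shows "expectation (\<lambda>\<omega>. \<bar>X \<omega>\<bar>) = sqrt 2 * expectation (\<lambda>\<omega>. max (X \<omega>) (Y \<omega>))"
proof -
  have "distributed M lborel (\<lambda>\<omega>. X \<omega> - Y \<omega>) (normal_density 0 (sqrt 2))"
    using diff_indep_normal[OF assms(1) _ _ X Y] by simp
  hence D: "distributed M lborel (\<lambda>\<omega>. (X \<omega> - Y \<omega>) / sqrt 2) std_normal_density"
    by (subst (asm) normal_standard_normal_convert) auto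
  note [simp] = std_normal_integrable[OF X] std_normal_integrable[OF Y]
  have "expectation (\<lambda>\<omega>. max (X \<omega>) (Y \<omega>)) = expectation (\<lambda>\<omega>. (X \<omega> + Y \<omega> + \<bar>X \<omega> - Y \<omega>\<bar>) / 2)"
    by (intro Bochner_Integration.integral_cong) (auto simp: max_def)
  \<comment> \<open>Both variables are centred, so only the absolute difference survives.\<close>
  also have "\<dots> = expectation (\<lambda>\<omega>. \<bar>X \<omega> - Y \<omega>\<bar>) / 2"
    by (simp add: standard_normal_distributed_expectation[OF X] standard_normal_distributed_expectation[OF Y])
  also have "\<dots> = sqrt 2 / 2 * expectation (\<lambda>\<omega>. \<bar>(X \<omega> - Y \<omega>) / sqrt 2\<bar>)"
    by simp
  also have "\<dots> = sqrt 2 / 2 * expectation (\<lambda>\<omega>. \<bar>X \<omega>\<bar>)"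
    using std_normal_expectation_abs_cong[OF D X] by simp
  finally have *: "expectation (\<lambda>\<omega>. max (X \<omega>) (Y \<omega>)) = sqrt 2 / 2 * expectation (\<lambda>\<omega>. \<bar>X \<omega>\<bar>)" .
  show ?thesis unfolding * by simp
qed
text \<open>Restrictions of the family to the disjoint sets \<open>{i}\<close> and
  \<open>{j}\<close> are independent; evaluating them at \<open>i\<close> and \<open>j\<close>
  recovers the two variables.\<close>

lemma indep_vars_imp_indep_var:
  assumes "indep_vars N X I" "i \<in> I" "j \<in> I" "i \<noteq> j"
  shows "indep_var (N i) (X i) (N j) (X j)"
proof -
  have "indep_var (PiM {i} N) (\<lambda>\<omega>. restrict (\<lambda>k. X k \<omega>) {i}) (PiM {j} N) (\<lambda>\<omega>. restrict (\<lambda>k. X k \<omega>) {j})"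
    using assms by (intro indep_var_restrict) auto
  from indep_var_compose[OF this, of "\<lambda>f. f i" "N i" "\<lambda>f. f j" "N j"]
  show ?thesis by (simp add: o_def measurable_component_singleton)
qed

text \<open>Symmetry gives the first equation. Strict and weak inequalities are matched so that the
  others follow from a complement and a disjoint union.\<close>

lemma std_normal_prob_intervals:
  assumes X: "distributed M lborel X std_normal_density" and "0 \<le> t"
  shows "\<P>(\<omega> in M. X \<omega> < - t) = \<P>(\<omega> in M. t < X \<omega>)"
    and "\<P>(\<omega> in M. X \<omega> \<le> t) = 1 - \<P>(\<omega> in M. t < X \<omega>)"
    and "\<P>(\<omega> in M. \<bar>X \<omega>\<bar> \<le> t) = 1 - 2 * \<P>(\<omega> in M. t < X \<omega>)"
proof -
  have [measurable]: "X \<in> borel_measurable M" using X by (simp add: distributed_def)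
  show 1: "\<P>(\<omega> in M. X \<omega> < - t) = \<P>(\<omega> in M. t < X \<omega>)"
    using std_normal_prob_cong[OF X std_normal_uminus[OF X], of "{t<..}"]
    by (simp add: less_minus_iff)
  have "\<P>(\<omega> in M. \<not> t < X \<omega>) = 1 - \<P>(\<omega> in M. t < X \<omega>)"
    by (rule prob_neg) measurable
  thus 2: "\<P>(\<omega> in M. X \<omega> \<le> t) = 1 - \<P>(\<omega> in M. t < X \<omega>)"
    by (simp add: not_less)
  have "{\<omega> \<in> space M. X \<omega> \<le> t} = {\<omega> \<in> space M. \<bar>X \<omega>\<bar> \<le> t} \<union> {\<omega> \<in> space M. X \<omega> < - t}"
    using \<open>0 \<le> t\<close> by auto
  also have "prob \<dots> = \<P>(\<omega> in M. \<bar>X \<omega>\<bar> \<le> t) + \<P>(\<omega> in M. X \<omega> < - t)"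
    by (rule finite_measure_Union) auto
  finally show "\<P>(\<omega> in M. \<bar>X \<omega>\<bar> \<le> t) = 1 - 2 * \<P>(\<omega> in M. t < X \<omega>)"
    using 1 2 by simp
qed

section \<open>Expected maxima of Gaussian families as tail integrals\<close>

context
  fixes X :: "'i \<Rightarrow> 'a \<Rightarrow> real" and I J :: "'i set" and Z :: "'a \<Rightarrow> real"
  assumes indep: "indep_vars (\<lambda>_. borel) X I"
    and normal: "\<And>i. i \<in> I \<Longrightarrow> distributed M lborel (X i) std_normal_density"
    and J: "J \<subseteq> I" "finite J" "J \<noteq> {}"
    and Z: "distributed M lborel Z std_normal_density"
begin

text \<open>In \<open>layer_cake\<close>, the maximum is at most \<open>t\<close> iff all variables
  are, and below \<open>- t\<close> iff all are; independence turns both into powers. The fixed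
  \<open>Z\<close> puts one common tail function into this integrand and the next, so that they can
  be compared pointwise.\<close>

lemma expectation_Max_std_normal:
  "has_bochner_integral lborel
    (\<lambda>t. indicator {0..} t * (1 - (1 - \<P>(\<omega> in M. t < Z \<omega>)) ^ card J - \<P>(\<omega> in M. t < Z \<omega>) ^ card J))
    (expectation (\<lambda>\<omega>. Max ((\<lambda>i. X i \<omega>) ` J)))" (is "has_bochner_integral _ ?f ?E")
proof -
  let ?m = "\<lambda>\<omega>. Max ((\<lambda>i. X i \<omega>) ` J)"
  have int: "integrable M ?m"
    using J normal by (intro integrable_Max std_normal_integrable) auto
  hence [measurable]: "?m \<in> borel_measurable M" by simp
  have "indicator {0..} t * (\<P>(\<omega> in M. t < ?m \<omega>) - \<P>(\<omega> in M. ?m \<omega> < - t)) = ?f t" for t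
  proof (cases "0 \<le> t")
    case True
    have "\<P>(\<omega> in M. \<forall>i\<in>J. X i \<omega> \<in> {..t}) = (1 - \<P>(\<omega> in M. t < Z \<omega>)) ^ card J"
    proof (rule indep_vars_prob_Ball[OF indep J])
      fix i assume "i \<in> J"
      with std_normal_prob_cong[OF normal Z, of i "{..t}"] J std_normal_prob_intervals[OF Z True]
      show "\<P>(\<omega> in M. X i \<omega> \<in> {..t}) = 1 - \<P>(\<omega> in M. t < Z \<omega>)" by auto
    qed simp
    hence "\<P>(\<omega> in M. \<not> t < ?m \<omega>) = (1 - \<P>(\<omega> in M. t < Z \<omega>)) ^ card J"
      using J by (simp add: not_less)
    moreover have "\<P>(\<omega> in M. \<not> t < ?m \<omega>) = 1 - \<P>(\<omega> in M. t < ?m \<omega>)"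
      by (rule prob_neg) measurable
    moreover have "\<P>(\<omega> in M. \<forall>i\<in>J. X i \<omega> \<in> {..<-t}) = \<P>(\<omega> in M. t < Z \<omega>) ^ card J"
    proof (rule indep_vars_prob_Ball[OF indep J])
      fix i assume "i \<in> J"
      with std_normal_prob_cong[OF normal Z, of i "{..<-t}"] J std_normal_prob_intervals[OF Z True]
      show "\<P>(\<omega> in M. X i \<omega> \<in> {..<-t}) = \<P>(\<omega> in M. t < Z \<omega>)" by auto
    qed simp
    hence "\<P>(\<omega> in M. ?m \<omega> < - t) = \<P>(\<omega> in M. t < Z \<omega>) ^ card J"
      using J by simp
    ultimately show ?thesis by simp
  qed simp
  with layer_cake[OF int] show ?thesis by (simp only:)
qed

lemma expectation_Max_abs_std_normal:
  "has_bochner_integral lborel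
    (\<lambda>t. indicator {0..} t * (1 - (1 - 2 * \<P>(\<omega> in M. t < Z \<omega>)) ^ card J))
    (expectation (\<lambda>\<omega>. Max ((\<lambda>i. \<bar>X i \<omega>\<bar>) ` J)))" (is "has_bochner_integral _ ?f ?E")
proof -
  let ?m = "\<lambda>\<omega>. Max ((\<lambda>i. \<bar>X i \<omega>\<bar>) ` J)"
  have int: "integrable M ?m"
    using J normal by (intro integrable_Max integrable_abs std_normal_integrable) auto
  hence [measurable]: "?m \<in> borel_measurable M" by simp
  have "indicator {0..} t * (\<P>(\<omega> in M. t < ?m \<omega>) - \<P>(\<omega> in M. ?m \<omega> < - t)) = ?f t" for t
  proof (cases "0 \<le> t")
    case True
    have "\<P>(\<omega> in M. \<forall>i\<in>J. X i \<omega> \<in> {-t..t}) = (1 - 2 * \<P>(\<omega> in M. t < Z \<omega>)) ^ card J"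
    proof (rule indep_vars_prob_Ball[OF indep J])
      fix i assume "i \<in> J"
      with std_normal_prob_cong[OF normal Z, of i "{-t..t}"] J std_normal_prob_intervals[OF Z True]
      show "\<P>(\<omega> in M. X i \<omega> \<in> {-t..t}) = 1 - 2 * \<P>(\<omega> in M. t < Z \<omega>)"
        by (auto simp: abs_le_iff minus_le_iff conj_commute)
    qed simp
    hence "\<P>(\<omega> in M. \<not> t < ?m \<omega>) = (1 - 2 * \<P>(\<omega> in M. t < Z \<omega>)) ^ card J"
      using J by (simp add: not_less abs_le_iff minus_le_iff conj_commute)
    moreover have "\<P>(\<omega> in M. \<not> t < ?m \<omega>) = 1 - \<P>(\<omega> in M. t < ?m \<omega>)"
      by (rule prob_neg) measurable
    \<comment> \<open>A maximum of absolute values is nonnegative and \<open>- t \<le> 0\<close>, so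
      the lower tail in \<open>layer_cake\<close> vanishes.\<close>
    moreover have "\<not> ?m \<omega> < - t" for \<omega> using J True by auto
    hence "\<P>(\<omega> in M. ?m \<omega> < - t) = 0" by (simp only: simp_thms Collect_const if_False measure_empty)
    ultimately show ?thesis by simp
  qed simp
  with layer_cake[OF int] show ?thesis by (simp only:)
qed

end

end

section \<open>Comparison of the two expected maxima\<close>

theorem theorem2p1:
  fixes M :: "'a measure" and \<eta> :: "nat \<Rightarrow> 'a \<Rightarrow> real" and n :: nat
  assumes "prob_space M"
    and "n \<ge> 1"
    and "prob_space.indep_vars M (\<lambda>_. borel) \<eta> {1..2*n}"
    and "\<And>i. i \<in> {1..2*n} \<Longrightarrow> distributed M lborel (\<eta> i) std_normal_density"
  shows "integral\<^sup>L M (\<lambda>\<omega>. Max ((\<lambda>i. \<eta> i \<omega>) ` {1..2*n}))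
           \<le> integral\<^sup>L M (\<lambda>\<omega>. Max ((\<lambda>i. \<bar>\<eta> i \<omega>\<bar>) ` {1..n}))
       \<and> integral\<^sup>L M (\<lambda>\<omega>. Max ((\<lambda>i. \<bar>\<eta> i \<omega>\<bar>) ` {1..n}))
           \<le> sqrt (real (2*n) / (real (2*n) - 1)) * integral\<^sup>L M (\<lambda>\<omega>. Max ((\<lambda>i. \<eta> i \<omega>) ` {1..2*n}))"
proof -
  interpret prob_space M by fact
  let ?I = "{1..2*n}" and ?c = "sqrt (real (2*n) / (real (2*n) - 1))"
  note indep = assms(3) and normal = assms(4)
  define p where "p t = \<P>(\<omega> in M. t < \<eta> 1 \<omega>)" for t
  have N1: "distributed M lborel (\<eta> 1) std_normal_density" using normal assms(2) by simp
  have p: "0 \<le> p t" "p t \<le> 1 / 2" if "0 \<le> t" for t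
  proof -
    \<comment> \<open>This probability equals \<open>1 - 2 * p t\<close>.\<close>
    have "0 \<le> \<P>(\<omega> in M. \<bar>\<eta> 1 \<omega>\<bar> \<le> t)" by simp
    thus "p t \<le> 1 / 2" using std_normal_prob_intervals(3)[OF N1 that] unfolding p_def by linarith
  qed (simp add: p_def)
  let ?f = "\<lambda>t. indicator {0..} t * (1 - (1 - p t) ^ (2 * n) - p t ^ (2 * n))"
  let ?g = "\<lambda>t. indicator {0..} t * (1 - (1 - 2 * p t) ^ n)"
  let ?E = "expectation (\<lambda>\<omega>. Max ((\<lambda>i. \<eta> i \<omega>) ` ?I))"
  let ?F = "expectation (\<lambda>\<omega>. Max ((\<lambda>i. \<bar>\<eta> i \<omega>\<bar>) ` {1..n}))"
  have f: "has_bochner_integral lborel ?f ?E"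
    using expectation_Max_std_normal[OF indep normal subset_refl _ _ N1] assms(2) by (simp add: p_def)
  have g: "has_bochner_integral lborel ?g ?F"
    using expectation_Max_abs_std_normal[OF indep normal _ _ _ N1, of "{1..n}"] assms(2)
    by (simp add: p_def)
  have "?E \<le> ?F"
  proof (rule has_bochner_integral_mono[OF f g])
    fix t show "?f t \<le> ?g t"
      using tail_lower_bound[of "p t" n] p[of t] by (simp split: split_indicator)
  qed
  moreover have "?F \<le> ?c * ?E"
  proof (cases "n = 1")
    case True
    \<comment> \<open>For \<open>n = 1\<close> the maxima reduce to
      \<open>max (\<eta> 1 \<omega>) (\<eta> 2 \<omega>)\<close> and
      \<open>\<bar>\<eta> 1 \<omega>\<bar>\<close>, and \<open>?c\<close> to
      \<open>sqrt 2\<close>.\<close>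
    have "{1..2::nat} = {1, 2}" by auto
    moreover have "indep_var borel (\<eta> 1) borel (\<eta> 2)"
      using True by (intro indep_vars_imp_indep_var[OF indep]) auto
    hence "expectation (\<lambda>\<omega>. \<bar>\<eta> 1 \<omega>\<bar>) = sqrt 2 * expectation (\<lambda>\<omega>. max (\<eta> 1 \<omega>) (\<eta> 2 \<omega>))"
      using True by (intro expectation_max_two_std_normal normal) auto
    ultimately show ?thesis using True by simp
  next
    case False
    show ?thesis
    proof (rule has_bochner_integral_mono[OF g has_bochner_integral_mult_right[OF f]])
      fix t show "?g t \<le> ?c * ?f t"
        using tail_upper_bound[of n "p t"] p[of t] False assms(2) by (simp split: split_indicator)
    qed
  qed
  ultimately show ?thesis by blast
qed

end
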